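(* Let $\mathcal{N}$ be a non-degenerate nilpotent Lie group of step two. Let $\mathbf{k}=(k_1,\dots,k_n)\in\mathbb{Z}_{\ge0}^n$, $\tau\in\mathbb{R}^r\setminus\{0\}$ and $\lambda=\sum_{j=1}^n\mu_j(\tau)(2k_j+1)$. Then the function $$\Psi_{\mathbf{k},\tau}^{(\lambda)}(\mathbf{y},\mathbf{t})=e^{i\mathbf{t}\cdot\tau}\,\widetilde{\mathscr L}_{\mathbf{k}}^{(\mathbf{0})}(\mathbf{y},\tau)$$ is a joint eigenfunction of $\Delta_b$ and $i\mathbf{T}$: $$(\lambda\mathbf{I}-\Delta_b)\Psi_{\mathbf{k},\tau}^{(\lambda)}=0,\qquad(-\tau_\beta\mathbf{I}-i\mathbf{T}_\beta)\Psi_{\mathbf{k},\tau}^{(\lambda)}=0,\quad\beta=1,\dots,r.$$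
   Context: Let $n,r\ge1$ and let $B=(B^1,\dots,B^r):\mathbb{R}^{2n}\times\mathbb{R}^{2n}\to\mathbb{R}^r$ be a skew-symmetric bilinear map, $B^\beta(\mathbf{x},\mathbf{y})=\sum_{k,l}B^\beta_{kl}x_ky_l$. The nilpotent Lie group of step two $\mathcal{N}$ is $\mathbb{R}^{2n}\times\mathbb{R}^r$ with product $(\mathbf{x},\mathbf{t})\cdot(\mathbf{y},\mathbf{s})=(\mathbf{x}+\mathbf{y},\mathbf{t}+\mathbf{s}+2B(\mathbf{x},\mathbf{y}))$. For $\tau\in\mathbb{R}^r$ let $B^\tau=\sum_\beta\tau_\beta B^\beta$, the skew-symmetric $2n\times2n$ matrix with $B^\beta=(B^\beta_{kl})$. $\mathcal{N}$ is non-degenerate if $B^\tau$ is invertible for every $\tau\ne0$. Left invariant vector fields: $\mathbf{Y}_k=\partial_{y_k}+2\sum_{\beta=1}^r\sum_{l=1}^{2n}B^\beta_{lk}y_l\partial_{t_\beta}$, $k=1,\dots,2n$. Sub-Laplacian: $\Delta_b=-\frac14\sum_{k=1}^{2n}\mathbf{Y}_k\mathbf{Y}_k$. $\mathbf{T}=(\mathbf{T}_1,\dots,\mathbf{T}_r)$, $\mathbf{T}_\beta=\partial/\partial t_\beta$. For $\tau\ne0$ let $\pm i\mu_1(\tau),\dots,\pm i\mu_n(\tau)$, $\mu_1(\tau)\ge\dots\ge\mu_n(\tau)>0$, be the eigenvalues of $B^\tau$, and choose an orthonormal basis $v_1^\tau,\dots,v_{2n}^\tau$ of $\mathbb{R}^{2n}$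 (depending only on $\tau/|\tau|$) such that $O(\tau)=(v_1^\tau,\dots,v_{2n}^\tau)$ satisfies $O(\tau)^tB^\tau O(\tau)=$ block diagonal matrix with blocks $\begin{pmatrix}0&-\mu_j(\tau)\\ \mu_j(\tau)&0\end{pmatrix}$. Write $\mathbf{y}=\sum_k y_k^\tau v_k^\tau$ and $\mathbf{y}_j^\tau=(y_{2j-1}^\tau,y_{2j}^\tau)$. With $L_k^{(p)}$ the generalized Laguerre polynomials, $$\widetilde{\mathscr L}_{\mathbf{k}}^{(\mathbf{0})}(\mathbf{y},\tau)=\prod_{j=1}^n\frac{2\mu_j(\tau)}{\pi}L_{k_j}^{(0)}\big(2\mu_j(\tau)|\mathbf{y}_j^\tau|^2\big)e^{-\mu_j(\tau)|\mathbf{y}_j^\tau|^2}.$$ *)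

theory Defs
  imports "HOL-Analysis.Analysis"
begin

section \<open>Nilpotent Lie groups of step two\<close>

text \<open>
  The space of dimension \<open>2n\<close> is \<open>real ^ 'm\<close> with \<open>CARD('m) = 2 * n\<close>; the group is
  \<open>(real ^ 'm) \<times> (real ^ 'r)\<close>, and it is determined by the skew-symmetric bilinear map \<open>B\<close>.
\<close>

definition skew_bilinear :: "(real ^ 'm \<Rightarrow> real ^ 'm \<Rightarrow> real ^ 'r) \<Rightarrow> bool" where
  "skew_bilinear B \<longleftrightarrow> bilinear B \<and> (\<forall>x y. B x y = - B y x)"

definition nil_mult ::
  "(real ^ 'm \<Rightarrow> real ^ 'm \<Rightarrow> real ^ 'r) \<Rightarrow>
   (real ^ 'm) \<times> (real ^ 'r) \<Rightarrow> (real ^ 'm) \<times> (real ^ 'r) \<Rightarrow> (real ^ 'm) \<times> (real ^ 'r)" where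
  "nil_mult B p q = (fst p + fst q, snd p + snd q + 2 *\<^sub>R B (fst p) (fst q))"

definition B_entry :: "(real ^ 'm \<Rightarrow> real ^ 'm \<Rightarrow> real ^ 'r) \<Rightarrow> 'r \<Rightarrow> 'm \<Rightarrow> 'm \<Rightarrow> real" where
  "B_entry B \<beta> k l = B (axis k 1) (axis l 1) $ \<beta>"

definition B_mat :: "(real ^ 'm \<Rightarrow> real ^ 'm \<Rightarrow> real ^ 'r) \<Rightarrow> real ^ 'r \<Rightarrow> real ^ 'm ^ 'm" where
  "B_mat B \<tau> = (\<chi> k l. \<Sum>\<beta>\<in>UNIV. \<tau> $ \<beta> * B_entry B \<beta> k l)"

definition nondegenerate :: "(real ^ 'm \<Rightarrow> real ^ 'm \<Rightarrow> real ^ 'r) \<Rightarrow> bool" where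
  "nondegenerate B \<longleftrightarrow> (\<forall>\<tau>. \<tau> \<noteq> 0 \<longrightarrow> invertible (B_mat B \<tau>))"


section \<open>Differential operators\<close>

text \<open>
  \<open>vector_derivative\<close> is total, so all the operators below are total as well; they are the
  classical ones wherever the derivatives involved exist.
\<close>

definition partial_y ::
  "'m \<Rightarrow> ((real ^ 'm) \<times> (real ^ 'r) \<Rightarrow> complex) \<Rightarrow> (real ^ 'm) \<times> (real ^ 'r) \<Rightarrow> complex" where
  "partial_y k f p = vector_derivative (\<lambda>s. f (fst p + s *\<^sub>R axis k 1, snd p)) (at 0)"

definition T_field ::
  "'r \<Rightarrow> ((real ^ 'm) \<times> (real ^ 'r) \<Rightarrow> complex) \<Rightarrow> (real ^ 'm) \<times> (real ^ 'r) \<Rightarrow> complex" where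
  "T_field \<beta> f p = vector_derivative (\<lambda>s. f (fst p, snd p + s *\<^sub>R axis \<beta> 1)) (at 0)"

definition Y_field ::
  "(real ^ 'm \<Rightarrow> real ^ 'm \<Rightarrow> real ^ 'r) \<Rightarrow> 'm \<Rightarrow>
   ((real ^ 'm) \<times> (real ^ 'r) \<Rightarrow> complex) \<Rightarrow> (real ^ 'm) \<times> (real ^ 'r) \<Rightarrow> complex" where
  "Y_field B k f p =
     partial_y k f p
     + 2 * (\<Sum>\<beta>\<in>UNIV. \<Sum>l\<in>UNIV. of_real (B_entry B \<beta> l k * fst p $ l) * T_field \<beta> f p)"

definition sub_laplacian ::
  "(real ^ 'm \<Rightarrow> real ^ 'm \<Rightarrow> real ^ 'r) \<Rightarrow>
   ((real ^ 'm) \<times> (real ^ 'r) \<Rightarrow> complex) \<Rightarrow> (real ^ 'm) \<times> (real ^ 'r) \<Rightarrow> complex" where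
  "sub_laplacian B f p = - (1 / 4) * (\<Sum>k\<in>UNIV. Y_field B k (Y_field B k f) p)"

text \<open>
  The fields \<open>Y_field B k\<close> are left invariant: they differentiate along the right translations
  by the one-parameter subgroups in the coordinate directions of \<open>real ^ 'm\<close>.
\<close>

lemma Y_field_left_invariant:
  fixes B :: "real ^ 'm \<Rightarrow> real ^ 'm \<Rightarrow> real ^ 'r"
  assumes B: "skew_bilinear B" and f: "f differentiable (at p)"
  shows "Y_field B k f p
         = vector_derivative (\<lambda>s. f (nil_mult B p (s *\<^sub>R axis k 1, 0))) (at 0)"
proof -
  have bl: "bilinear B" using B by (simp add: skew_bilinear_def)
  obtain D where D: "(f has_derivative D) (at p)"
    using f by (auto simp: differentiable_def)
  then have linD: "linear D" by (rule has_derivative_linear)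
  have dir: "vector_derivative (\<lambda>s. f (p + s *\<^sub>R w)) (at 0) = D w" for w
  proof (rule vector_derivative_at)
    have "((\<lambda>s. p + s *\<^sub>R w) has_derivative (\<lambda>s. s *\<^sub>R w)) (at 0)"
      by (auto intro!: derivative_eq_intros)
    then have "((\<lambda>s. f (p + s *\<^sub>R w)) has_derivative (\<lambda>s. D (s *\<^sub>R w))) (at 0)"
      using has_derivative_compose[of "\<lambda>s. p + s *\<^sub>R w" "\<lambda>s. s *\<^sub>R w" 0 UNIV f D] D by simp
    then show "((\<lambda>s. f (p + s *\<^sub>R w)) has_vector_derivative D w) (at 0)"
      by (simp add: has_vector_derivative_def linear_scale[OF linD])
  qed
  have py: "partial_y k f p = D (axis k 1, 0)"
    using dir[of "(axis k 1, 0)"] by (simp add: partial_y_def plus_prod_def)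
  have pt: "T_field \<beta> f p = D (0, axis \<beta> 1)" for \<beta>
    using dir[of "(0, axis \<beta> 1)"] by (simp add: T_field_def plus_prod_def)
  have linB: "linear (\<lambda>x. B x z)" "linear (B x)" for x z
    using bl by (auto simp: bilinear_def)
  have vecm: "z = (\<Sum>l\<in>UNIV. (z $ l) *\<^sub>R axis l 1)" for z :: "real ^ 'm"
    by (simp add: basis_expansion flip: scalar_mult_eq_scaleR)
  have Bx: "B (fst p) (axis k 1) = (\<Sum>l\<in>UNIV. (fst p $ l) *\<^sub>R B (axis l 1) (axis k 1))"
    using linear_sum[OF linB(1), of "\<lambda>l. (fst p $ l) *\<^sub>R axis l 1" UNIV] vecm[of "fst p"]
    by (simp add: linear_scale[OF linB(1)])
  have Bc: "B (fst p) (axis k 1) $ \<beta> = (\<Sum>l\<in>UNIV. B_entry B \<beta> l k * fst p $ l)" for \<beta>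
    by (subst Bx) (simp only: sum_component vector_scaleR_component B_entry_def real_scaleR_def mult.commute)
  have vec: "z = (\<Sum>\<beta>\<in>UNIV. (z $ \<beta>) *\<^sub>R axis \<beta> 1)" for z :: "real ^ 'r"
    by (simp add: basis_expansion flip: scalar_mult_eq_scaleR)
  have lin2: "linear (\<lambda>z. D (0, z))"
    by (rule linearI) (simp_all add: linear_add[OF linD, symmetric] linear_scale[OF linD, symmetric])
  have D2: "D (0, z) = (\<Sum>\<beta>\<in>UNIV. (z $ \<beta>) *\<^sub>R D (0, axis \<beta> 1))" for z
    using linear_sum[OF lin2, of "\<lambda>\<beta>. (z $ \<beta>) *\<^sub>R axis \<beta> 1" UNIV] vec[of z]
    by (simp add: linear_scale[OF lin2])
  have "(\<lambda>s. f (nil_mult B p (s *\<^sub>R axis k 1, 0)))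
        = (\<lambda>s. f (p + s *\<^sub>R (axis k 1, 2 *\<^sub>R B (fst p) (axis k 1))))"
    by (rule ext) (simp add: nil_mult_def plus_prod_def linear_scale[OF linB(2)] mult.commute)
  then have "vector_derivative (\<lambda>s. f (nil_mult B p (s *\<^sub>R axis k 1, 0))) (at 0)
        = D (axis k 1, 2 *\<^sub>R B (fst p) (axis k 1))"
    by (simp only: dir)
  also have "\<dots> = D (axis k 1, 0) + D (0, 2 *\<^sub>R B (fst p) (axis k 1))"
    by (simp add: linear_add[OF linD, symmetric])
  also have "D (0, 2 *\<^sub>R B (fst p) (axis k 1)) = 2 * D (0, B (fst p) (axis k 1))"
    using linear_scale[OF lin2, of 2] by (simp add: scaleR_conv_of_real)
  also have "D (0, B (fst p) (axis k 1))
        = (\<Sum>\<beta>\<in>UNIV. \<Sum>l\<in>UNIV. of_real (B_entry B \<beta> l k * fst p $ l) * D (0, axis \<beta> 1))"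
    by (subst D2) (simp add: Bc scaleR_conv_of_real sum_distrib_right)
  finally show ?thesis by (simp add: Y_field_def py pt)
qed


section \<open>Spectral data of the matrices \<open>B_mat B \<tau>\<close>\<close>

text \<open>
  \<open>\<plusminus> i \<mu> 1, \<dots>, \<plusminus> i \<mu> n\<close> with \<open>\<mu> 1 \<ge> \<dots> \<ge> \<mu> n > 0\<close> are the eigenvalues of \<open>M\<close>, counted with
  multiplicity, i.e. the roots of its characteristic polynomial. Values of \<open>\<mu>\<close> outside
  \<open>{1..n}\<close> are irrelevant.
\<close>

definition eigenvalue_list :: "nat \<Rightarrow> real ^ 'm ^ 'm \<Rightarrow> (nat \<Rightarrow> real) \<Rightarrow> bool" where
  "eigenvalue_list n M \<mu> \<longleftrightarrow>
     (\<forall>j\<in>{1..n}. 0 < \<mu> j) \<and>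
     (\<forall>i\<in>{1..n}. \<forall>j\<in>{1..n}. i \<le> j \<longrightarrow> \<mu> j \<le> \<mu> i) \<and>
     (\<forall>z::complex. det (mat z - (\<chi> k l. of_real (M $ k $ l)))
        = (\<Prod>j=1..n. (z - \<i> * of_real (\<mu> j)) * (z + \<i> * of_real (\<mu> j))))"

definition orthonormal_basis :: "nat \<Rightarrow> (nat \<Rightarrow> real ^ 'm) \<Rightarrow> bool" where
  "orthonormal_basis N v \<longleftrightarrow>
     (\<forall>i\<in>{1..N}. \<forall>j\<in>{1..N}. v i \<bullet> v j = (if i = j then 1 else 0)) \<and>
     span (v ` {1..N}) = UNIV"

text \<open>
  Entry \<open>(i, j)\<close>, with indices starting at 1, of the block diagonal matrix whose \<open>p\<close>-th block
  occupies the rows and columns \<open>2p - 1, 2p\<close> and has first row \<open>0, - \<mu> p\<close> and second row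
  \<open>\<mu> p, 0\<close>.
\<close>

definition block_entry :: "(nat \<Rightarrow> real) \<Rightarrow> nat \<Rightarrow> nat \<Rightarrow> real" where
  "block_entry \<mu> i j =
     (if odd i \<and> j = i + 1 then - \<mu> (j div 2)
      else if odd j \<and> i = j + 1 then \<mu> (i div 2)
      else 0)"

text \<open>
  For \<open>O = (v 1, \<dots>, v (2n))\<close> the entry \<open>(i, j)\<close> of \<open>O\<^sup>t M O\<close> is \<open>v i \<bullet> (M *v v j)\<close>.
\<close>

definition normal_form_basis ::
  "nat \<Rightarrow> real ^ 'm ^ 'm \<Rightarrow> (nat \<Rightarrow> real) \<Rightarrow> (nat \<Rightarrow> real ^ 'm) \<Rightarrow> bool" where
  "normal_form_basis n M \<mu> v \<longleftrightarrow>
     orthonormal_basis (2 * n) v \<and>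
     (\<forall>i\<in>{1..2*n}. \<forall>j\<in>{1..2*n}. v i \<bullet> (M *v v j) = block_entry \<mu> i j)"

definition coord :: "nat \<Rightarrow> (nat \<Rightarrow> real ^ 'm) \<Rightarrow> real ^ 'm \<Rightarrow> nat \<Rightarrow> real" where
  "coord n v y k = representation (v ` {1..2*n}) y (v k)"


section \<open>The exponential Laguerre functions\<close>

definition laguerre :: "nat \<Rightarrow> real \<Rightarrow> real \<Rightarrow> real" where
  "laguerre k p x =
     (\<Sum>i\<le>k. (- 1) ^ i * ((of_nat k + p) gchoose (k - i)) * x ^ i / fact i)"

text \<open>
  The sum of the two squared coordinates is the squared Euclidean norm of the pair of
  coordinates of \<open>y\<close> with indices \<open>2j - 1\<close> and \<open>2j\<close>.
\<close>

definition exp_laguerre ::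
  "nat \<Rightarrow> (real ^ 'r \<Rightarrow> nat \<Rightarrow> real) \<Rightarrow> (real ^ 'r \<Rightarrow> nat \<Rightarrow> real ^ 'm) \<Rightarrow>
   (nat \<Rightarrow> nat) \<Rightarrow> real ^ 'm \<Rightarrow> real ^ 'r \<Rightarrow> real" where
  "exp_laguerre n \<mu> v k y \<tau> =
     (\<Prod>j=1..n.
        let \<rho> = (coord n (v \<tau>) y (2 * j - 1))\<^sup>2 + (coord n (v \<tau>) y (2 * j))\<^sup>2
        in 2 * \<mu> \<tau> j / pi * laguerre (k j) 0 (2 * \<mu> \<tau> j * \<rho>) * exp (- \<mu> \<tau> j * \<rho>))"

definition Psi ::
  "nat \<Rightarrow> (real ^ 'r \<Rightarrow> nat \<Rightarrow> real) \<Rightarrow> (real ^ 'r \<Rightarrow> nat \<Rightarrow> real ^ 'm) \<Rightarrow>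
   (nat \<Rightarrow> nat) \<Rightarrow> real ^ 'r \<Rightarrow> (real ^ 'm) \<times> (real ^ 'r) \<Rightarrow> complex" where
  "Psi n \<mu> v k \<tau> p =
     exp (\<i> * of_real (snd p \<bullet> \<tau>)) * of_real (exp_laguerre n \<mu> v k (fst p) \<tau>)"

end

theory Submission
  imports Defs "HOL-Computational_Algebra.Polynomial"
begin

text \<open>
  Write \<open>M = B_mat B \<tau>\<close>. On a function \<open>exp (\<i> t \<bullet> \<tau>) g y\<close> each \<open>T \<beta>\<close> acts as multiplication by
  \<open>\<i> \<tau> \<beta>\<close>, so the sub-Laplacian becomes the twisted Laplacian
  \<open>- \<Delta>g / 4 - \<i> (y v* M) \<bullet> \<nabla>g + |y v* M|\<^sup>2 g\<close> on the factor \<open>g\<close>. In the normal form basis, \<open>M\<close> rotates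
  each coordinate plane with speed \<open>\<mu> j\<close>, hence the first-order term kills every function of the
  squared radii \<open>\<rho> j\<close>, and the operator separates into the radial ones
  \<open>- (\<rho> G'' + G') + \<mu> j\<^sup>2 \<rho> G\<close>. For \<open>G = L (2 \<mu> j \<rho>) exp (- \<mu> j \<rho>)\<close> with \<open>L\<close> the Laguerre polynomial of
  degree \<open>k j\<close>, the Laguerre equation says that this is \<open>\<mu> j (2 k j + 1) G\<close>.
\<close>

section \<open>Laguerre's equation\<close>

text \<open>Passing to formal polynomials makes every derivative a \<open>pderiv\<close>, so the
  differential equation becomes a recursion between coefficients.\<close>

definition laguerre_poly :: "nat \<Rightarrow> real \<Rightarrow> real poly" where
  "laguerre_poly k p =
     (\<Sum>i\<le>k. monom ((- 1) ^ i * ((of_nat k + p) gchoose (k - i)) / fact i) i)"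

lemma poly_laguerre_poly: "poly (laguerre_poly k p) x = laguerre k p x"
  by (simp add: laguerre_poly_def laguerre_def poly_sum poly_monom)

lemma coeff_laguerre_poly:
  "coeff (laguerre_poly k p) i =
     (if i \<le> k then (- 1) ^ i * ((of_nat k + p) gchoose (k - i)) / fact i else 0)"
  by (simp add: laguerre_poly_def coeff_sum)

text \<open>The ratio of the consecutive binomials \<open>a gchoose Suc d\<close> and
  \<open>a gchoose d\<close> is \<open>(a - d) / Suc d\<close>. At \<open>i = k\<close> the factor
  \<open>real i - real k\<close> and the coefficient of index \<open>Suc k\<close> both vanish;
  beyond that both coefficients are zero.\<close>

lemma laguerre_poly_coeff_Suc:
  "real (Suc i) * (real (Suc i) + p) * coeff (laguerre_poly k p) (Suc i)
     = (real i - real k) * coeff (laguerre_poly k p) i"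
proof (cases "i < k")
  case True
  \<comment> \<open>Here \<open>d\<close> is \<open>k - i - 1\<close>: the coefficients of index
    \<open>i\<close> and \<open>Suc i\<close> carry binomials with lower entry \<open>Suc d\<close>
    and \<open>d\<close>, and \<open>a - d\<close> equals \<open>Suc i + p\<close>.\<close>
  then obtain d where d: "k = Suc (i + d)"
    using less_imp_Suc_add by blast
  define a where "a = of_nat k + p"
  have rec: "(a gchoose Suc d) * real (Suc d) = (a gchoose d) * (a - real d)"
    using gbinomial_mult_1[of a d] by (simp add: algebra_simps)
  have "real (Suc i) * (real (Suc i) + p) * coeff (laguerre_poly k p) (Suc i)
      = (real (Suc i) + p) * ((- 1) ^ Suc i * (a gchoose d) / fact i)"
    using True by (simp add: coeff_laguerre_poly d a_def divide_simps del: of_nat_Suc)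
  also have "\<dots> = (a - real d) * ((- 1) ^ Suc i * (a gchoose d) / fact i)"
    by (simp add: a_def d)
  also have "\<dots> = (- 1) ^ Suc i * ((a gchoose d) * (a - real d)) / fact i"
    by simp
  also have "\<dots> = (real i - real k) * coeff (laguerre_poly k p) i"
    unfolding rec[symmetric] using True
    by (simp add: coeff_laguerre_poly d a_def Suc_diff_le algebra_simps)
  finally show ?thesis .
qed (auto simp: coeff_laguerre_poly)

text \<open>Multiplication by the variable is \<open>pCons 0\<close>. In degree \<open>i\<close> the
  terms with the coefficient of index \<open>Suc i\<close> combine to the factor
  \<open>Suc i * (Suc i + p)\<close>, which is the left side of the recursion above.\<close>

lemma laguerre_poly_ode:
  "pCons 0 (pderiv (pderiv (laguerre_poly k p))) + [:p + 1, - 1:] * pderiv (laguerre_poly k p)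
     + smult (real k) (laguerre_poly k p) = 0" (is "?P = 0")
proof (rule poly_eqI)
  fix i
  show "coeff ?P i = coeff 0 i"
    using laguerre_poly_coeff_Suc[of i p k]
    by (cases i) (simp_all add: coeff_pderiv coeff_pCons algebra_simps)
qed

lemma laguerre_ode:
  "x * poly (pderiv (pderiv (laguerre_poly k p))) x
     + (p + 1 - x) * poly (pderiv (laguerre_poly k p)) x + real k * laguerre k p x = 0"
  using arg_cong[OF laguerre_poly_ode[of k p], of "\<lambda>q. poly q x"]
  by (simp add: poly_laguerre_poly algebra_simps)

lemma laguerre_0: "laguerre k p 0 = (of_nat k + p) gchoose k"
  by (simp add: poly_laguerre_poly[symmetric] poly_0_coeff_0 coeff_laguerre_poly)

text \<open>This is Laguerre's equation for \<open>p = 0\<close>, taken at \<open>2 * m * x\<close>.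
  The exponential produces the term \<open>m\<^sup>2 * x\<close>, which cancels between the two
  sides; their difference is then the Laguerre expression times \<open>2 * m\<close> and the
  exponential prefactor.\<close>

lemma laguerre_profile_ode:
  fixes m :: real and k :: nat
  defines "G \<equiv> \<lambda>x. 2 * m / pi * laguerre k 0 (2 * m * x) * exp (- m * x)"
  obtains G' G'' where "\<And>x. (G has_real_derivative G' x) (at x)"
    and "\<And>x. (G' has_real_derivative G'' x) (at x)"
    and "\<And>x. x * G'' x + G' x = (m\<^sup>2 * x - m * (2 * real k + 1)) * G x"
proof -
  define L where "L = laguerre_poly k 0"
  define G' where "G' x = 2 * m / pi *
    (2 * m * poly (pderiv L) (2 * m * x) - m * poly L (2 * m * x)) * exp (- m * x)" for x
  define G'' where "G'' x = 2 * m / pi *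
    (4 * m\<^sup>2 * poly (pderiv (pderiv L)) (2 * m * x) - 4 * m\<^sup>2 * poly (pderiv L) (2 * m * x)
      + m\<^sup>2 * poly L (2 * m * x)) * exp (- m * x)" for x
  have dpoly: "((\<lambda>x. poly q (2 * m * x)) has_real_derivative 2 * m * poly (pderiv q) (2 * m * x)) (at x)"
    for q x
    using DERIV_chain2[where g = "(*) (2 * m)" and s = UNIV and Db = "2 * m" and x = x, OF poly_DERIV[of q]]
      DERIV_cmult_Id[of "2 * m"]
    by (simp add: mult.commute)
  \<comment> \<open>Differentiation changes only the factor in front of the exponential, from
    \<open>p\<close> to \<open>p' - m * p\<close>; this one rule serves for both \<open>G\<close>
    and \<open>G'\<close>.\<close>
  have dexp: "((\<lambda>x. c * p x * exp (- m * x)) has_real_derivative c * q * exp (- m * x)) (at x)"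
    if "(p has_real_derivative p') (at x)" "q = p' - m * p x" for c p p' q x
    using that by (auto intro!: derivative_eq_intros simp: algebra_simps)
  have "(G has_real_derivative G' x) (at x)" for x
    unfolding G_def G'_def poly_laguerre_poly[symmetric] L_def[symmetric]
    by (rule dexp[OF dpoly]) simp
  moreover have "(G' has_real_derivative G'' x) (at x)" for x
    unfolding G'_def[abs_def] G''_def
    by (rule dexp, rule DERIV_diff[OF dpoly[THEN DERIV_cmult] dpoly[THEN DERIV_cmult]])
      (simp add: algebra_simps power2_eq_square)
  moreover have "x * G'' x + G' x = (m\<^sup>2 * x - m * (2 * real k + 1)) * G x" for x
  proof -
    define l where "l = poly L (2 * m * x)"
    define l' where "l' = poly (pderiv L) (2 * m * x)"
    define l'' where "l'' = poly (pderiv (pderiv L)) (2 * m * x)"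
    define E where "E = 2 * m / pi * exp (- m * x)"
    have ode: "2 * m * x * l'' + (1 - 2 * m * x) * l' + real k * l = 0"
      using laguerre_ode[of "2 * m * x" k 0]
      by (simp add: l_def l'_def l''_def L_def poly_laguerre_poly)
    have "x * G'' x + G' x - (m\<^sup>2 * x - m * (2 * real k + 1)) * G x
        = E * (x * (4 * m\<^sup>2 * l'' - 4 * m\<^sup>2 * l' + m\<^sup>2 * l) + (2 * m * l' - m * l)
            - (m\<^sup>2 * x - m * (2 * real k + 1)) * l)"
      unfolding G''_def G'_def G_def poly_laguerre_poly[symmetric] L_def[symmetric]
        l_def[symmetric] l'_def[symmetric] l''_def[symmetric] E_def
      by (simp add: field_simps)
    also have "\<dots> = E * (2 * m) * (2 * m * x * l'' + (1 - 2 * m * x) * l' + real k * l)"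
      by (simp add: algebra_simps power2_eq_square)
    also have "\<dots> = 0"
      by (simp add: ode)
    finally show ?thesis by simp
  qed
  ultimately show thesis
    by (rule that)
qed

section \<open>The twisted Laplacian\<close>

text \<open>The profile \<open>h\<close> is complex valued because applying \<open>Y_field\<close>
  to a wave with real profile gives a wave whose profile is complex.\<close>

definition wave :: "real ^ 'r \<Rightarrow> (real ^ 'm \<Rightarrow> complex) \<Rightarrow> (real ^ 'm) \<times> (real ^ 'r) \<Rightarrow> complex" where
  "wave \<tau> h p = exp (\<i> * of_real (snd p \<bullet> \<tau>)) * h (fst p)"

lemma wave_differentiable:
  assumes "h differentiable (at (fst p))"
  shows "wave \<tau> h differentiable (at p)"
proof -
  have fst: "fst differentiable (at p)" and snd: "snd differentiable (at p)"
    by (auto intro!: differentiableI derivative_intros)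
  have "(\<lambda>p. \<i> * complex_of_real (snd p \<bullet> \<tau>)) differentiable (at p)"
    by (rule differentiableI) (auto intro!: derivative_eq_intros)
  moreover have "(exp :: complex \<Rightarrow> complex) differentiable (at z)" for z
    using DERIV_exp has_field_derivative_imp_has_derivative differentiableI by blast
  ultimately have "(\<lambda>p. exp (\<i> * complex_of_real (snd p \<bullet> \<tau>))) differentiable (at p)"
    by (rule differentiable_compose[rotated])
  moreover have "(\<lambda>p. h (fst p)) differentiable (at p)"
    using assms fst by (rule differentiable_compose)
  ultimately show ?thesis
    unfolding wave_def[abs_def] by (rule differentiable_mult)
qed

lemma T_field_wave: "T_field \<beta> (wave \<tau> h) p = \<i> * of_real (\<tau> $ \<beta>) * wave \<tau> h p"
  unfolding T_field_def
proof (rule vector_derivative_at)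
  have "((\<lambda>s. exp (\<i> * (of_real (snd p \<bullet> \<tau>) + s * of_real (\<tau> $ \<beta>))) * h (fst p))
      has_field_derivative \<i> * of_real (\<tau> $ \<beta>) * wave \<tau> h p) (at (of_real 0))"
    by (auto intro!: derivative_eq_intros simp: wave_def)
  from has_vector_derivative_real_field[OF this]
  show "((\<lambda>s. wave \<tau> h (fst p, snd p + s *\<^sub>R axis \<beta> 1))
      has_vector_derivative \<i> * of_real (\<tau> $ \<beta>) * wave \<tau> h p) (at 0)"
    by (simp add: wave_def inner_add_left inner_axis' )
qed

lemma partial_y_wave:
  assumes "(h has_derivative h') (at (fst p))"
  shows "partial_y k (wave \<tau> h) p = wave \<tau> (\<lambda>_. h' (axis k 1)) p"
  unfolding partial_y_def
proof (rule vector_derivative_at)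
  have "((\<lambda>s. fst p + s *\<^sub>R axis k 1) has_derivative (\<lambda>s. s *\<^sub>R axis k 1)) (at 0)"
    by (auto intro!: derivative_eq_intros)
  then have "((\<lambda>s. h (fst p + s *\<^sub>R axis k 1)) has_derivative (\<lambda>s. h' (s *\<^sub>R axis k 1))) (at 0)"
    using has_derivative_compose[of "\<lambda>s. fst p + s *\<^sub>R axis k 1" "\<lambda>s. s *\<^sub>R axis k 1" 0 UNIV h h']
      assms by simp
  then have "((\<lambda>s. h (fst p + s *\<^sub>R axis k 1)) has_vector_derivative h' (axis k 1)) (at 0)"
    by (simp add: has_vector_derivative_def linear_scale[OF has_derivative_linear[OF assms]])
  then show "((\<lambda>s. wave \<tau> h (fst p + s *\<^sub>R axis k 1, snd p))
      has_vector_derivative wave \<tau> (\<lambda>_. h' (axis k 1)) p) (at 0)"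
    unfolding wave_def by (auto intro!: derivative_eq_intros)
qed

lemma vector_B_mat_component:
  "(y v* B_mat B \<tau>) $ k = (\<Sum>\<beta>\<in>UNIV. \<Sum>l\<in>UNIV. B_entry B \<beta> l k * y $ l * \<tau> $ \<beta>)"
  unfolding vector_matrix_mult_def B_mat_def
  by (subst sum.swap) (simp add: sum_distrib_left sum_distrib_right ac_simps)

text \<open>Since every \<open>T_field \<beta>\<close> acts as a scalar on waves, the double sum in
  \<open>Y_field\<close> collapses to one component of \<open>y v* B_mat B \<tau>\<close>.\<close>

lemma Y_field_wave:
  assumes "(h has_derivative h') (at (fst p))"
  shows "Y_field B k (wave \<tau> h) p
    = wave \<tau> (\<lambda>y. h' (axis k 1) + 2 * \<i> * of_real ((y v* B_mat B \<tau>) $ k) * h y) p"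
  unfolding Y_field_def T_field_wave partial_y_wave[OF assms] vector_B_mat_component
  by (simp add: wave_def sum_distrib_left sum_distrib_right algebra_simps)

lemma B_mat_diag:
  assumes "skew_bilinear B"
  shows "B_mat B \<tau> $ k $ k = 0"
proof -
  have "B x x $ \<beta> = - (B x x $ \<beta>)" for x \<beta>
    using assms unfolding skew_bilinear_def by (metis vector_uminus_component)
  then have "B x x $ \<beta> = 0" for x \<beta>
    by (metis eq_neg_iff_add_eq_0 mult_2 mult_eq_0_iff zero_neq_numeral)
  then show ?thesis
    by (simp add: B_mat_def B_entry_def)
qed

text \<open>An equation between functions, not only between values at a point, so that
  \<open>Y_field\<close> can be applied to the result once more.\<close>

lemma Y_field_wave_gradient:
  fixes B :: "real ^ 'm \<Rightarrow> real ^ 'm \<Rightarrow> real ^ 'r"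
  assumes "\<And>y. (g has_derivative (\<lambda>h. h \<bullet> dg y)) (at y)"
  shows "Y_field B k (wave \<tau> (\<lambda>y. complex_of_real (g y)))
    = wave \<tau> (\<lambda>y. of_real (dg y $ k) + 2 * \<i> * of_real ((y v* B_mat B \<tau>) $ k * g y))"
proof
  fix p :: "(real ^ 'm) \<times> (real ^ 'r)"
  have "((\<lambda>y. complex_of_real (g y)) has_derivative (\<lambda>h. of_real (h \<bullet> dg (fst p)))) (at (fst p))"
    by (rule has_derivative_of_real[OF assms])
  from Y_field_wave[OF this]
  show "Y_field B k (wave \<tau> (\<lambda>y. complex_of_real (g y))) p
    = wave \<tau> (\<lambda>y. of_real (dg y $ k) + 2 * \<i> * of_real ((y v* B_mat B \<tau>) $ k * g y)) p"
    by (simp add: wave_def inner_axis')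
qed

text \<open>This is the product rule for the profile produced by the first application of
  \<open>Y_field\<close>. It feeds the second application and also yields the differentiability of
  the first one.\<close>

lemma twisted_gradient_has_derivative:
  fixes M :: "real ^ 'm ^ 'm"
  assumes g: "(g has_derivative (\<lambda>h. h \<bullet> dg y)) (at y)"
    and dg: "(dg has_derivative D) (at y)"
  shows "((\<lambda>y. complex_of_real (dg y $ k) + 2 * \<i> * of_real ((y v* M) $ k * g y)) has_derivative
     (\<lambda>h. of_real (D h $ k)
        + 2 * \<i> * of_real ((h v* M) $ k * g y + (y v* M) $ k * (h \<bullet> dg y)))) (at y)"
proof -
  have A: "((\<lambda>y. (y v* M) $ k) has_derivative (\<lambda>h. (h v* M) $ k)) (at y)"
    unfolding vector_matrix_mult_def
    by (auto intro!: derivative_eq_intros bounded_linear.has_derivative[OF bounded_linear_vec_nth])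
  show ?thesis
    by (auto intro!: derivative_eq_intros A g bounded_linear.has_derivative[OF bounded_linear_vec_nth dg]
        simp: algebra_simps)
qed

text \<open>Squaring the derivative along axis \<open>k\<close> plus \<open>2 * \<i>\<close> times
  the \<open>k\<close>-th component of \<open>y v* B_mat B \<tau>\<close> gives equal cross terms,
  hence the first-order part. The sum over \<open>D\<close> is the Laplacian of \<open>g\<close>, as
  the trace of its Hessian.\<close>

lemma sub_laplacian_wave:
  assumes B: "skew_bilinear B"
    and g: "\<And>y. (g has_derivative (\<lambda>h. h \<bullet> dg y)) (at y)"
    and dg: "\<And>y. (dg has_derivative D y) (at y)"
  shows "sub_laplacian B (wave \<tau> (\<lambda>y. complex_of_real (g y))) p
    = wave \<tau> (\<lambda>y. of_real ((y v* B_mat B \<tau>) \<bullet> (y v* B_mat B \<tau>) * g y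
         - (\<Sum>k\<in>UNIV. D y (axis k 1) $ k) / 4)
       - \<i> * of_real ((y v* B_mat B \<tau>) \<bullet> dg y)) p"
proof -
  define y where "y = fst p"
  define A where "A = y v* B_mat B \<tau>"
  have diag: "(axis k 1 v* B_mat B \<tau>) $ k = 0" for k
    using B_mat_diag[OF B, of \<tau> k]
    by (simp add: vector_matrix_mult_def axis_def if_distrib[of "\<lambda>x. x * _"] cong: if_cong)
  \<comment> \<open>The term with the derivative of \<open>(y v* M) $ k\<close> drops out since \<open>M\<close> has zero diagonal.\<close>
  have YY: "Y_field B k (Y_field B k (wave \<tau> (\<lambda>y. complex_of_real (g y)))) p
     = exp (\<i> * of_real (snd p \<bullet> \<tau>)) *
        (of_real (D y (axis k 1) $ k - 4 * (A $ k * A $ k) * g y) + 4 * \<i> * of_real (A $ k * dg y $ k))"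
    for k
    unfolding Y_field_wave_gradient[OF g] Y_field_wave[OF twisted_gradient_has_derivative[OF g dg]]
    unfolding diag
    by (simp add: wave_def A_def y_def inner_axis' algebra_simps)
  have "(\<Sum>k\<in>UNIV. Y_field B k (Y_field B k (wave \<tau> (\<lambda>y. complex_of_real (g y)))) p)
     = exp (\<i> * of_real (snd p \<bullet> \<tau>)) *
        (of_real ((\<Sum>k\<in>UNIV. D y (axis k 1) $ k) - 4 * (A \<bullet> A) * g y) + 4 * \<i> * of_real (A \<bullet> dg y))"
    unfolding YY
    by (simp add: inner_vec_def sum_distrib_left sum_distrib_right sum.distrib sum_subtractf
        algebra_simps)
  then show ?thesis
    unfolding sub_laplacian_def by (simp add: wave_def A_def y_def field_simps)
qed

section \<open>Normal form bases\<close>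

lemma orthonormal_basis_inner:
  "orthonormal_basis N v \<Longrightarrow> i \<in> {1..N} \<Longrightarrow> j \<in> {1..N} \<Longrightarrow> v i \<bullet> v j = (if i = j then 1 else 0)"
  by (simp add: orthonormal_basis_def)

lemma orthonormal_basis_eqI:
  assumes v: "orthonormal_basis N v" and eq: "\<And>i. i \<in> {1..N} \<Longrightarrow> v i \<bullet> x = v i \<bullet> y"
  shows "x = y"
proof -
  have "orthogonal (x - y) z" if "z \<in> v ` {1..N}" for z
    using that eq by (auto simp: orthogonal_def inner_diff_left inner_commute[of _ "v _"])
  then have "orthogonal (x - y) (x - y)"
    using v orthogonal_to_span[of "x - y" "v ` {1..N}"] by (simp add: orthonormal_basis_def)
  then show ?thesis
    by (simp add: orthogonal_self)
qed

lemma orthonormal_basis_expansion: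
  assumes v: "orthonormal_basis N v"
  shows "(\<Sum>i\<in>{1..N}. (v i \<bullet> y) *\<^sub>R v i) = y"
proof (rule orthonormal_basis_eqI[OF v])
  fix j assume j: "j \<in> {1..N}"
  have "v j \<bullet> (\<Sum>i\<in>{1..N}. (v i \<bullet> y) *\<^sub>R v i) = (\<Sum>i\<in>{1..N}. if j = i then v i \<bullet> y else 0)"
    unfolding inner_sum_right
    using orthonormal_basis_inner[OF v j] by (intro sum.cong) auto
  then show "v j \<bullet> (\<Sum>i\<in>{1..N}. (v i \<bullet> y) *\<^sub>R v i) = v j \<bullet> y"
    using j by simp
qed

lemma orthonormal_basis_parseval:
  assumes v: "orthonormal_basis N v"
  shows "x \<bullet> x = (\<Sum>i\<in>{1..N}. (v i \<bullet> x)\<^sup>2)"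
proof -
  have "x \<bullet> x = x \<bullet> (\<Sum>i\<in>{1..N}. (v i \<bullet> x) *\<^sub>R v i)"
    by (simp only: orthonormal_basis_expansion[OF v])
  also have "\<dots> = (\<Sum>i\<in>{1..N}. (v i \<bullet> x)\<^sup>2)"
    by (simp add: inner_sum_right power2_eq_square inner_commute)
  finally show ?thesis .
qed

text \<open>\<open>coord\<close> refers to the set of basis vectors, not to their indices.
  Orthonormality makes that set independent and the indexing injective, so pairing the expansion of
  \<open>y\<close> with \<open>v k\<close> isolates one coefficient.\<close>

lemma coord_eq_inner:
  assumes v: "orthonormal_basis (2 * n) v" and k: "k \<in> {1..2 * n}"
  shows "coord n v y k = v k \<bullet> y"
proof -
  let ?S = "v ` {1..2 * n}"
  have ind: "independent ?S"
  proof (rule pairwise_orthogonal_independent)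
    show "pairwise orthogonal ?S"
      using orthonormal_basis_inner[OF v] by (auto simp: pairwise_def orthogonal_def split: if_splits)
    show "0 \<notin> ?S"
      using orthonormal_basis_inner[OF v] by fastforce
  qed
  have "(\<Sum>b\<in>?S. representation ?S y b *\<^sub>R b) = y"
    using v ind by (intro real_vector.sum_representation_eq) (auto simp: orthonormal_basis_def)
  then have "v k \<bullet> y = v k \<bullet> (\<Sum>b\<in>?S. representation ?S y b *\<^sub>R b)"
    by simp
  also have "\<dots> = (\<Sum>b\<in>?S. if b = v k then representation ?S y b else 0)"
    unfolding inner_sum_right
  proof (intro sum.cong refl)
    fix b assume "b \<in> ?S"
    then obtain i where i: "i \<in> {1..2 * n}" "b = v i"
      by auto
    have "v k \<bullet> v i = (if v i = v k then 1 else 0)"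
      using orthonormal_basis_inner[OF v k] i k by (metis (full_types))
    then show "v k \<bullet> (representation ?S y b *\<^sub>R b) = (if b = v k then representation ?S y b else 0)"
      using i by simp
  qed
  also have "\<dots> = coord n v y k"
    using k by (simp add: coord_def)
  finally show ?thesis by simp
qed

section \<open>Action of the matrix on a normal form basis\<close>

text \<open>Column \<open>2 * j - 1\<close> of the block matrix has a single nonzero entry,
  \<open>\<mu> j\<close> in row \<open>2 * j\<close>; comparing inner products with all basis
  vectors recovers the image.\<close>

lemma normal_form_basis_matrix_odd:
  assumes v: "normal_form_basis n M \<mu> v" and j: "j \<in> {1..n}"
  shows "M *v v (2 * j - 1) = \<mu> j *\<^sub>R v (2 * j)"
proof (rule orthonormal_basis_eqI)
  show ob: "orthonormal_basis (2 * n) v"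
    using v by (simp add: normal_form_basis_def)
  fix i assume i: "i \<in> {1..2 * n}"
  have "2 * j - 1 \<in> {1..2 * n}"
    using j by auto
  then have "v i \<bullet> (M *v v (2 * j - 1)) = block_entry \<mu> i (2 * j - 1)"
    using v i unfolding normal_form_basis_def by blast
  also have "\<dots> = v i \<bullet> (\<mu> j *\<^sub>R v (2 * j))"
    using j i orthonormal_basis_inner[OF ob i, of "2 * j"]
    by (cases j) (auto simp: block_entry_def)
  finally show "v i \<bullet> (M *v v (2 * j - 1)) = v i \<bullet> (\<mu> j *\<^sub>R v (2 * j))" .
qed

lemma normal_form_basis_matrix_even:
  assumes v: "normal_form_basis n M \<mu> v" and j: "j \<in> {1..n}"
  shows "M *v v (2 * j) = - \<mu> j *\<^sub>R v (2 * j - 1)"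
proof (rule orthonormal_basis_eqI)
  show ob: "orthonormal_basis (2 * n) v"
    using v by (simp add: normal_form_basis_def)
  fix i assume i: "i \<in> {1..2 * n}"
  have "v i \<bullet> (M *v v (2 * j)) = block_entry \<mu> i (2 * j)"
    using v i j by (auto simp: normal_form_basis_def)
  also have "\<dots> = v i \<bullet> (- \<mu> j *\<^sub>R v (2 * j - 1))"
    using j i orthonormal_basis_inner[OF ob i, of "2 * j - 1"]
    by (cases j) (auto simp: block_entry_def)
  finally show "v i \<bullet> (M *v v (2 * j)) = v i \<bullet> (- \<mu> j *\<^sub>R v (2 * j - 1))" .
qed

section \<open>Coordinate planes and squared radii\<close>

text \<open>For orthonormal \<open>a\<close> and \<open>b\<close> this is the orthogonal projection
  onto their plane, and \<open>plane_sq\<close> is the squared length of the projected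
  vector.\<close>

definition plane_proj :: "real ^ 'm \<Rightarrow> real ^ 'm \<Rightarrow> real ^ 'm \<Rightarrow> real ^ 'm" where
  "plane_proj a b y = (a \<bullet> y) *\<^sub>R a + (b \<bullet> y) *\<^sub>R b"

definition plane_sq :: "real ^ 'm \<Rightarrow> real ^ 'm \<Rightarrow> real ^ 'm \<Rightarrow> real" where
  "plane_sq a b y = (a \<bullet> y)\<^sup>2 + (b \<bullet> y)\<^sup>2"

lemma has_derivative_plane_proj:
  "(plane_proj a b has_derivative plane_proj a b) (at y)"
  unfolding plane_proj_def[abs_def] by (auto intro!: derivative_eq_intros)

lemma has_derivative_plane_sq:
  "(plane_sq a b has_derivative (\<lambda>h. h \<bullet> (2 *\<^sub>R plane_proj a b y))) (at y)"
  unfolding plane_sq_def[abs_def]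
  by (auto intro!: derivative_eq_intros simp: plane_proj_def inner_add_right inner_commute algebra_simps)

lemma sum_even_odd:
  fixes f :: "nat \<Rightarrow> 'a::comm_monoid_add"
  shows "(\<Sum>i\<in>{1..2 * n}. f i) = (\<Sum>j=1..n. f (2 * j - 1) + f (2 * j))"
  by (induction n) (simp_all add: add.assoc)

text \<open>Move \<open>M\<close> onto the basis vectors and apply Parseval: in plane
  \<open>j\<close> the two components are those of \<open>y\<close>, exchanged and multiplied by
  \<open>\<mu> j\<close> up to sign.\<close>

lemma normal_form_basis_norm:
  assumes v: "normal_form_basis n M \<mu> v"
  shows "(y v* M) \<bullet> (y v* M) = (\<Sum>j=1..n. (\<mu> j)\<^sup>2 * plane_sq (v (2 * j - 1)) (v (2 * j)) y)"
proof -
  have "(y v* M) \<bullet> (y v* M) = (\<Sum>i\<in>{1..2 * n}. (v i \<bullet> (y v* M))\<^sup>2)"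
    using v by (intro orthonormal_basis_parseval) (simp add: normal_form_basis_def)
  also have "\<dots> = (\<Sum>j=1..n. ((y v* M) \<bullet> v (2 * j - 1))\<^sup>2 + ((y v* M) \<bullet> v (2 * j))\<^sup>2)"
    unfolding sum_even_odd by (simp add: inner_commute)
  also have "\<dots> = (\<Sum>j=1..n. (\<mu> j)\<^sup>2 * plane_sq (v (2 * j - 1)) (v (2 * j)) y)"
    unfolding dot_lmul_matrix
    by (intro sum.cong refl, unfold normal_form_basis_matrix_odd[OF v] normal_form_basis_matrix_even[OF v])
      (simp add: plane_sq_def power_mult_distrib inner_commute algebra_simps)
  finally show ?thesis .
qed

text \<open>In each plane \<open>y v* M\<close> is tangent to the circle through \<open>y\<close>,
  whereas the projection is radial. Concretely, two equal products of coordinates occur with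
  opposite signs.\<close>

lemma normal_form_basis_rotation:
  assumes v: "normal_form_basis n M \<mu> v" and j: "j \<in> {1..n}"
  shows "(y v* M) \<bullet> plane_proj (v (2 * j - 1)) (v (2 * j)) y = 0"
  unfolding plane_proj_def inner_add_right inner_scaleR_right dot_lmul_matrix
    normal_form_basis_matrix_odd[OF v j] normal_form_basis_matrix_even[OF v j]
  by (simp add: inner_commute)

section \<open>Products of radial functions\<close>

text \<open>The index set is a parameter so that a product with one factor removed is again a
  \<open>radial_prod\<close>. Derivatives can then be written without dividing by a factor that may
  vanish.\<close>

definition radial_prod ::
  "'j set \<Rightarrow> ('j \<Rightarrow> real ^ 'm) \<Rightarrow> ('j \<Rightarrow> real ^ 'm) \<Rightarrow>
    ('j \<Rightarrow> real \<Rightarrow> real) \<Rightarrow> real ^ 'm \<Rightarrow> real" where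
  "radial_prod I a b G y = (\<Prod>j\<in>I. G j (plane_sq (a j) (b j) y))"

definition radial_grad ::
  "'j set \<Rightarrow> ('j \<Rightarrow> real ^ 'm) \<Rightarrow> ('j \<Rightarrow> real ^ 'm) \<Rightarrow>
    ('j \<Rightarrow> real \<Rightarrow> real) \<Rightarrow> ('j \<Rightarrow> real \<Rightarrow> real) \<Rightarrow> real ^ 'm \<Rightarrow> real ^ 'm" where
  "radial_grad I a b G G' y =
     (\<Sum>j\<in>I. (G' j (plane_sq (a j) (b j) y) * radial_prod (I - {j}) a b G y)
        *\<^sub>R (2 *\<^sub>R plane_proj (a j) (b j) y))"

lemma has_derivative_radial_factor:
  assumes "\<And>x. (G has_real_derivative G' x) (at x)"
  shows "((\<lambda>y. G (plane_sq a b y)) has_derivative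
    (\<lambda>h. G' (plane_sq a b y) * (h \<bullet> (2 *\<^sub>R plane_proj a b y)))) (at y)"
  using has_derivative_compose[OF has_derivative_plane_sq
      assms[of "plane_sq a b y", THEN has_field_derivative_imp_has_derivative]] .

lemma has_derivative_radial_prod:
  assumes "\<And>j x. (G j has_real_derivative G' j x) (at x)"
  shows "(radial_prod I a b G has_derivative (\<lambda>h. h \<bullet> radial_grad I a b G G' y)) (at y)"
  unfolding radial_prod_def[abs_def] radial_grad_def inner_sum_right inner_scaleR_right
  by (rule has_derivative_eq_rhs[OF has_derivative_prod[OF has_derivative_radial_factor[OF assms]]])
    (simp add: radial_prod_def algebra_simps)

text \<open>The Hessian as a linear map in the direction \<open>h\<close>. The three terms come from
  differentiating the factor \<open>G' j\<close>, the remaining product, and the linear vector field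
  \<open>plane_proj\<close>.\<close>

definition radial_hess ::
  "'j set \<Rightarrow> ('j \<Rightarrow> real ^ 'm) \<Rightarrow> ('j \<Rightarrow> real ^ 'm) \<Rightarrow> ('j \<Rightarrow> real \<Rightarrow> real) \<Rightarrow> ('j \<Rightarrow> real \<Rightarrow> real) \<Rightarrow> ('j \<Rightarrow> real \<Rightarrow> real) \<Rightarrow>
    real ^ 'm \<Rightarrow> real ^ 'm \<Rightarrow> real ^ 'm" where
  "radial_hess I a b G G' G'' y h =
     (\<Sum>j\<in>I.
        (G'' j (plane_sq (a j) (b j) y) * (h \<bullet> (2 *\<^sub>R plane_proj (a j) (b j) y))
            * radial_prod (I - {j}) a b G y
          + G' j (plane_sq (a j) (b j) y) * (h \<bullet> radial_grad (I - {j}) a b G G' y))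
          *\<^sub>R (2 *\<^sub>R plane_proj (a j) (b j) y)
        + (G' j (plane_sq (a j) (b j) y) * radial_prod (I - {j}) a b G y)
          *\<^sub>R (2 *\<^sub>R plane_proj (a j) (b j) h))"

lemma has_derivative_radial_grad:
  assumes "\<And>j x. (G j has_real_derivative G' j x) (at x)"
    and "\<And>j x. (G' j has_real_derivative G'' j x) (at x)"
  shows "(radial_grad I a b G G' has_derivative radial_hess I a b G G' G'' y) (at y)"
  unfolding radial_grad_def[of I a b G G', abs_def] radial_hess_def[abs_def]
  by (rule has_derivative_sum, rule has_derivative_eq_rhs,
      rule has_derivative_scaleR[OF has_derivative_mult[OF has_derivative_radial_factor[OF assms(2)]
        has_derivative_radial_prod[OF assms(1)]]
        has_derivative_scaleR_right[OF has_derivative_plane_proj]])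
    (simp add: algebra_simps)

section \<open>The Laplacian as the trace of the Hessian\<close>

text \<open>This is the trace of the rank-one map that sends \<open>h\<close> to
  \<open>(h \<bullet> u) *\<^sub>R w\<close>.\<close>

lemma sum_axis_inner: "(\<Sum>k\<in>UNIV. (axis k 1 \<bullet> u) * w $ k) = u \<bullet> (w :: real ^ 'm)"
  unfolding inner_axis' by (simp add: inner_vec_def)

lemma sum_axis_plane_proj:
  "(\<Sum>k\<in>UNIV. plane_proj a b (axis k 1) $ k) = a \<bullet> a + b \<bullet> b"
  by (simp add: plane_proj_def sum.distrib sum_axis_inner inner_commute[of _ "axis _ _"])

lemma plane_proj_orthogonal:
  assumes "a \<bullet> a' = 0" "a \<bullet> b' = 0" "b \<bullet> a' = 0" "b \<bullet> b' = 0"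
  shows "plane_proj a b y \<bullet> plane_proj a' b' z = 0"
  using assms by (simp add: plane_proj_def inner_add_left inner_add_right inner_commute)

lemma plane_proj_inner_self:
  assumes "a \<bullet> a = 1" "b \<bullet> b = 1" "a \<bullet> b = 0"
  shows "plane_proj a b y \<bullet> plane_proj a b y = plane_sq a b y"
  using assms
  by (simp add: plane_proj_def plane_sq_def inner_add_left inner_add_right inner_commute power2_eq_square)

text \<open>Distinct factors live in orthogonal planes, so mixed terms vanish. Within one plane the
  squared radius \<open>\<rho> j\<close> has squared gradient length \<open>4 * \<rho> j\<close> and
  Laplacian 4.\<close>

lemma trace_radial_hess:
  assumes ab: "\<And>j. j \<in> I \<Longrightarrow> a j \<bullet> a j = 1 \<and> b j \<bullet> b j = 1 \<and> a j \<bullet> b j = 0"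
    and orth: "\<And>i j. i \<in> I \<Longrightarrow> j \<in> I \<Longrightarrow> i \<noteq> j \<Longrightarrow>
      a i \<bullet> a j = 0 \<and> a i \<bullet> b j = 0 \<and> b i \<bullet> a j = 0 \<and> b i \<bullet> b j = 0"
  shows "(\<Sum>k\<in>UNIV. radial_hess I a b G G' G'' y (axis k 1) $ k) =
    (\<Sum>j\<in>I. 4 * (plane_sq (a j) (b j) y * G'' j (plane_sq (a j) (b j) y)
        + G' j (plane_sq (a j) (b j) y)) * radial_prod (I - {j}) a b G y)"
proof -
  define \<rho> where "\<rho> j = plane_sq (a j) (b j) y" for j
  define P where "P j = radial_prod (I - {j}) a b G y" for j
  define w where "w j = 2 *\<^sub>R plane_proj (a j) (b j) y" for j
  define c where "c j = radial_grad (I - {j}) a b G G' y" for j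
  have ww: "w j \<bullet> w j = 4 * \<rho> j" if "j \<in> I" for j
    using ab[OF that] by (simp add: w_def \<rho>_def plane_proj_inner_self)
  \<comment> \<open>\<open>c j\<close> is the gradient of the product of the other factors, hence a
    combination of vectors in the other planes.\<close>
  have cw: "c j \<bullet> w j = 0" if j: "j \<in> I" for j
    unfolding c_def radial_grad_def inner_sum_left w_def
    using orth j by (intro sum.neutral) (auto simp: plane_proj_orthogonal)
  have "(\<Sum>k\<in>UNIV. radial_hess I a b G G' G'' y (axis k 1) $ k)
     = (\<Sum>k\<in>UNIV. \<Sum>j\<in>I. G'' j (\<rho> j) * P j * ((axis k 1 \<bullet> w j) * w j $ k)
         + G' j (\<rho> j) * ((axis k 1 \<bullet> c j) * w j $ k)
         + G' j (\<rho> j) * P j * 2 * (plane_proj (a j) (b j) (axis k 1) $ k))"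
    unfolding radial_hess_def \<rho>_def[symmetric] P_def[symmetric] w_def[symmetric] c_def[symmetric]
    by (simp add: algebra_simps)
  also have "\<dots> = (\<Sum>j\<in>I. G'' j (\<rho> j) * P j * (w j \<bullet> w j) + G' j (\<rho> j) * (c j \<bullet> w j)
         + G' j (\<rho> j) * P j * 2 * (a j \<bullet> a j + b j \<bullet> b j))"
    by (subst sum.swap)
      (simp only: sum.distrib sum_distrib_left[symmetric] sum_axis_inner sum_axis_plane_proj)
  also have "\<dots> = (\<Sum>j\<in>I. 4 * (\<rho> j * G'' j (\<rho> j) + G' j (\<rho> j)) * P j)"
    using ww cw ab by (intro sum.cong) (simp_all add: algebra_simps)
  finally show ?thesis
    by (simp only: \<rho>_def P_def)
qed

section \<open>Joint eigenfunctions\<close>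

text \<open>The operators are total, so the equations come with the differentiability that gives
  them their classical meaning; the nonzero value excludes the trivial solution.\<close>

theorem proposition2p4:
  fixes n :: nat
    and B :: "real ^ 'm \<Rightarrow> real ^ 'm \<Rightarrow> real ^ 'r"
    and \<mu> :: "real ^ 'r \<Rightarrow> nat \<Rightarrow> real"
    and v :: "real ^ 'r \<Rightarrow> nat \<Rightarrow> real ^ 'm"
    and k :: "nat \<Rightarrow> nat"
    and \<tau> :: "real ^ 'r"
    and lam :: real
  assumes "CARD('m) = 2 * n"
    and "skew_bilinear B"
    and "nondegenerate B"
    and "\<And>\<sigma>. \<sigma> \<noteq> 0 \<Longrightarrow> eigenvalue_list n (B_mat B \<sigma>) (\<mu> \<sigma>)"
    and "\<And>\<sigma>. \<sigma> \<noteq> 0 \<Longrightarrow> normal_form_basis n (B_mat B \<sigma>) (\<mu> \<sigma>) (v \<sigma>)"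
    and "\<And>\<sigma> i. \<sigma> \<noteq> 0 \<Longrightarrow> i \<in> {1..2*n} \<Longrightarrow> v \<sigma> i = v (\<sigma> /\<^sub>R norm \<sigma>) i"
    and "\<tau> \<noteq> 0"
    and "lam = (\<Sum>j=1..n. \<mu> \<tau> j * (2 * real (k j) + 1))"
  shows "(\<forall>p. Psi n \<mu> v k \<tau> differentiable (at p)) \<and>
         (\<forall>l p. Y_field B l (Psi n \<mu> v k \<tau>) differentiable (at p)) \<and>
         (\<exists>p. Psi n \<mu> v k \<tau> p \<noteq> 0) \<and>
         (\<forall>p. of_real lam * Psi n \<mu> v k \<tau> p - sub_laplacian B (Psi n \<mu> v k \<tau>) p = 0) \<and>
         (\<forall>\<beta> p. - of_real (\<tau> $ \<beta>) * Psi n \<mu> v k \<tau> p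
                 - \<i> * T_field \<beta> (Psi n \<mu> v k \<tau>) p = 0)"
proof -
  define M where "M = B_mat B \<tau>"
  define m where "m = \<mu> \<tau>"
  define a where "a j = v \<tau> (2 * j - 1)" for j
  define b where "b j = v \<tau> (2 * j)" for j
  define G where "G j x = 2 * m j / pi * laguerre (k j) 0 (2 * m j * x) * exp (- m j * x)" for j x
  have nf: "normal_form_basis n M m (v \<tau>)"
    using assms by (simp add: M_def m_def)
  then have ob: "orthonormal_basis (2 * n) (v \<tau>)"
    by (simp add: normal_form_basis_def)
  have m_pos: "m j > 0" if "j \<in> {1..n}" for j
    using assms(4)[OF \<open>\<tau> \<noteq> 0\<close>] that by (simp add: eigenvalue_list_def m_def)
  have "\<forall>j. \<exists>G' G''. (\<forall>x. (G j has_real_derivative G' x) (at x)) \<and>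
      (\<forall>x. (G' has_real_derivative G'' x) (at x)) \<and>
      (\<forall>x. x * G'' x + G' x = ((m j)\<^sup>2 * x - m j * (2 * real (k j) + 1)) * G j x)"
  proof
    fix j
    show "\<exists>G' G''. (\<forall>x. (G j has_real_derivative G' x) (at x)) \<and>
        (\<forall>x. (G' has_real_derivative G'' x) (at x)) \<and>
        (\<forall>x. x * G'' x + G' x = ((m j)\<^sup>2 * x - m j * (2 * real (k j) + 1)) * G j x)"
      unfolding G_def[abs_def] by (rule laguerre_profile_ode[of "m j" "k j"]) blast
  qed
  then obtain G' G'' where G: "\<And>j x. (G j has_real_derivative G' j x) (at x)"
    and G': "\<And>j x. (G' j has_real_derivative G'' j x) (at x)"
    and ode: "\<And>j x. x * G'' j x + G' j x = ((m j)\<^sup>2 * x - m j * (2 * real (k j) + 1)) * G j x"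
    unfolding choice_iff by blast
  define I where "I = {1..n}"
  define g where "g = radial_prod I a b G"
  define dg where "dg = radial_grad I a b G G'"
  define D where "D = radial_hess I a b G G' G''"
  have g: "(g has_derivative (\<lambda>h. h \<bullet> dg y)) (at y)" for y
    unfolding g_def dg_def by (rule has_derivative_radial_prod[OF G])
  have dg: "(dg has_derivative D y) (at y)" for y
    unfolding dg_def D_def by (rule has_derivative_radial_grad[OF G G'])
  have Psi: "Psi n \<mu> v k \<tau> = wave \<tau> (\<lambda>y. complex_of_real (g y))"
  proof -
    have "exp_laguerre n \<mu> v k y \<tau> = g y" for y
      unfolding exp_laguerre_def g_def radial_prod_def I_def Let_def
    proof (intro prod.cong refl)
      fix j assume "j \<in> {1..n}"
      then have "2 * j - 1 \<in> {1..2 * n}" "2 * j \<in> {1..2 * n}"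
        by auto
      from this[THEN coord_eq_inner[OF ob]]
      show "2 * \<mu> \<tau> j / pi * laguerre (k j) 0 (2 * \<mu> \<tau> j *
          ((coord n (v \<tau>) y (2 * j - 1))\<^sup>2 + (coord n (v \<tau>) y (2 * j))\<^sup>2)) *
          exp (- \<mu> \<tau> j * ((coord n (v \<tau>) y (2 * j - 1))\<^sup>2 + (coord n (v \<tau>) y (2 * j))\<^sup>2))
        = G j (plane_sq (a j) (b j) y)"
        by (simp only: G_def m_def plane_sq_def a_def b_def)
    qed
    then show ?thesis
      by (auto simp: Psi_def wave_def)
  qed
  \<comment> \<open>The profile equation turns each radial term into a multiple of
    \<open>G j\<close>, which restores the factor missing from the product. The quadratic parts add
    up to the squared length of \<open>y v* M\<close>, the constants to \<open>lam\<close>.\<close>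
  have trace: "(\<Sum>l\<in>UNIV. D y (axis l 1) $ l)
      = 4 * ((y v* M) \<bullet> (y v* M) * g y - lam * g y)" for y
  proof -
    define \<rho> where "\<rho> j = plane_sq (a j) (b j) y" for j
    have g_split: "G j (\<rho> j) * radial_prod (I - {j}) a b G y = g y" if "j \<in> I" for j
      unfolding g_def radial_prod_def \<rho>_def using that
      by (intro prod.remove[symmetric]) (simp_all add: I_def)
    have inner_v: "v \<tau> i \<bullet> v \<tau> j = (if i = j then 1 else 0)" if "i \<in> {1..2 * n}" "j \<in> {1..2 * n}" for i j
      using orthonormal_basis_inner[OF ob that] .
    have idx: "2 * j - 1 \<in> {1..2 * n} \<and> 2 * j \<in> {1..2 * n} \<and> 1 \<le> j" if "j \<in> I" for j
      using that by (auto simp: I_def)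
    have "(\<Sum>l\<in>UNIV. D y (axis l 1) $ l) = (\<Sum>j\<in>I. 4 * (\<rho> j * G'' j (\<rho> j) + G' j (\<rho> j))
        * radial_prod (I - {j}) a b G y)"
      unfolding D_def \<rho>_def
    proof (rule trace_radial_hess)
      fix j assume "j \<in> I"
      with idx[of j] show "a j \<bullet> a j = 1 \<and> b j \<bullet> b j = 1 \<and> a j \<bullet> b j = 0"
        unfolding a_def b_def by (auto simp: inner_v)
    next
      fix i j assume "i \<in> I" "j \<in> I" "i \<noteq> j"
      note i = idx[OF \<open>i \<in> I\<close>] and j = idx[OF \<open>j \<in> I\<close>]
      \<comment> \<open>Distinct planes use disjoint index pairs. The bound \<open>1 \<le> j\<close>
        from \<open>idx\<close> matters here, because subtraction on naturals truncates.\<close>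
      have "2 * i - 1 \<noteq> 2 * j - 1" "2 * i - 1 \<noteq> 2 * j" "2 * i \<noteq> 2 * j - 1" "2 * i \<noteq> 2 * j"
        using i[THEN conjunct2, THEN conjunct2] j[THEN conjunct2, THEN conjunct2] \<open>i \<noteq> j\<close>
        by presburger+
      with i j show "a i \<bullet> a j = 0 \<and> a i \<bullet> b j = 0 \<and> b i \<bullet> a j = 0 \<and> b i \<bullet> b j = 0"
        unfolding a_def b_def by (simp only: inner_v if_False simp_thms)
    qed
    also have "\<dots> = (\<Sum>j\<in>I. 4 * (((m j)\<^sup>2 * \<rho> j - m j * (2 * real (k j) + 1)) * g y))"
      using g_split by (intro sum.cong) (simp_all add: ode)
    also have "\<dots> = 4 * ((\<Sum>j\<in>I. (m j)\<^sup>2 * \<rho> j) * g y - lam * g y)"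
      unfolding assms(8) m_def[symmetric] I_def[symmetric]
      by (simp only: sum_distrib_left[symmetric] sum_distrib_right[symmetric] sum_subtractf left_diff_distrib)
    also have "(\<Sum>j\<in>I. (m j)\<^sup>2 * \<rho> j) = (y v* M) \<bullet> (y v* M)"
      unfolding normal_form_basis_norm[OF nf] I_def \<rho>_def a_def b_def ..
    finally show ?thesis .
  qed
  have rot: "(y v* M) \<bullet> dg y = 0" for y
    unfolding dg_def radial_grad_def inner_sum_right a_def b_def
    by (intro sum.neutral ballI)
      (simp only: I_def inner_scaleR_right normal_form_basis_rotation[OF nf] mult_zero_right)
  have "wave \<tau> (\<lambda>y. complex_of_real (g y)) differentiable (at p)" for p
    by (rule wave_differentiable, rule differentiableI, rule has_derivative_of_real[OF g])
  moreover have "Y_field B l (wave \<tau> (\<lambda>y. complex_of_real (g y))) differentiable (at p)" for l p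
    unfolding Y_field_wave_gradient[OF g]
    by (rule wave_differentiable, rule differentiableI, rule twisted_gradient_has_derivative[OF g dg])
  \<comment> \<open>At the origin all squared radii vanish and each Laguerre polynomial takes the
    value \<open>k j choose k j\<close>, which is 1, so only the positive normalizing factors
    remain.\<close>
  moreover have "wave \<tau> (\<lambda>y. complex_of_real (g y)) 0 \<noteq> 0"
  proof -
    have "g 0 = (\<Prod>j\<in>I. 2 * m j / pi)"
      by (simp add: g_def radial_prod_def plane_sq_def G_def laguerre_0 binomial_gbinomial[symmetric])
    also have "\<dots> \<noteq> 0"
      using m_pos by (force simp: I_def)
    finally show ?thesis
      by (simp add: wave_def)
  qed
  \<comment> \<open>\<open>rot\<close> removes the first-order term. By \<open>trace\<close>, minus
    a quarter of the Laplacian is \<open>lam * g\<close> minus the potential term, which the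
    potential of the twisted Laplacian cancels.\<close>
  moreover have "of_real lam * wave \<tau> (\<lambda>y. complex_of_real (g y)) p
      - sub_laplacian B (wave \<tau> (\<lambda>y. complex_of_real (g y))) p = 0" for p
    unfolding sub_laplacian_wave[OF \<open>skew_bilinear B\<close> g dg] M_def[symmetric] trace rot
    by (simp add: wave_def field_simps)
  moreover have "- of_real (\<tau> $ \<beta>) * wave \<tau> (\<lambda>y. complex_of_real (g y)) p
      - \<i> * T_field \<beta> (wave \<tau> (\<lambda>y. complex_of_real (g y))) p = 0" for \<beta> p
    by (simp add: T_field_wave flip: mult.assoc)
  ultimately show ?thesis
    unfolding Psi by blast
qed

end
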